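(* Let $\mathbb{K}=\mathbb{R}$ or $\mathbb{C}$, let a scalar product (bilinear or sesquilinear) on $\mathbb{K}^n$ be defined by a nonsingular matrix $N\in\mathbb{K}^{n\times n}$, and let $\sigma:\mathbb{K}^{n\times n}\to\mathbb{K}^{n\times n}$ be a generalized matrix sign function. Suppose a nonsingular matrix $F\in\mathbb{K}^{n\times n}$ has a decomposition $F=WS$ where, with $\Sigma=\sigma(F^{[N]}F)$, the matrix $W\in\mathbb{K}^{n\times n}$ is $(N,N\Sigma^{-1})$-unitary with $(W^{[N]})^{[N]}=W$ and the matrix $S\in\mathbb{K}^{n\times n}$ is $r$-positive-definite, $N$-selfadjoint and $N\Sigma$-selfadjoint. Then $F$ also has a decomposition $$F=S'W',$$ where, with $\Sigma'=\sigma(FF^{[N]})$, the matrix $S'\in\mathbb{K}^{n\times n}$ is $r$-positive-definite, $N$-selfadjoint and $N\Sigma'$-selfadjoint, and the matrix $W'\in\mathbb{K}^{n\times n}$ is $(N\Sigma',N)$-unitary. When such a decomposition exists it is unique, with $S'$ given by $S'=(\Sigma' FF^{[N]})^{1/2}$ (principal square root) and $W'=S'^{-1}F$. Moreover, the factors $W$ in $F=WS$ and $W'$ in $F=S'W'$ coincide: $W'=W$.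
   Context: Notation. $A^\#=A^T$ if the scalar product is a (real or complex) bilinear form $[x,y]_N=x^TNy$, and $A^\#=\bar A^T$ if it is a sesquilinear form $[x,y]_N=\bar x^TNy$; the same choice is used throughout. For $A\in\mathbb{K}^{n\times n}$ and nonsingular $N\in\mathbb{K}^{n\times n}$, $A^{[N]}=N^{-1}A^\# N$, and $A$ is $N$-selfadjoint if $A^{[N]}=A$, i.e. $A^\# N=NA$ (the same definition is used with $N$ replaced by any nonsingular matrix, e.g. $N\Sigma$ or $N\Sigma'$). For nonsingular $M,N\in\mathbb{K}^{n\times n}$, put $A^{[M,N]}=N^{-1}A^\# M$. A matrix $W\in\mathbb{K}^{n\times n}$ is $(M,N)$-unitary if $W^{[M,N]}W=I_n$ and $WW^{[M,N]}=I_n$ (for square matrices these two conditions are equivalent, and equivalent to $W^\# MW=N$). Thus $W$ is $(N,N\Sigma^{-1})$-unitary iff $W^\# NW=N\Sigma^{-1}$, and $(N\Sigma',N)$-unitary iff $W^\# N\Sigma' W=N$. A square matrix is $r$-positive-definite if all of its eigenvalues have positive real part. For a matrix $A$ with no eigenvalues in $(-\infty,0]$, $A^{1/2}$ is the principal square root: the unique square root of $A$ whose eigenvalues all lie in the open right half-plane. Primary matrix functions. A stem function $f$ assigns to each $\lambda$ in its domain in $\mathbb{C}$ a value $f(\lambda)=f^{(0)}(\lambda)$ and "derivative" values $f^{(j)}(\lambda)$, $j\ge1$, which may be arbitrarily assigned numbers at each $\lambda$. The associated primary matrix function is $f(A)=Qf(J)Q^{-1}$, where $A=QJQ^{-1}$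 is a (complex) Jordan decomposition and $f$ is applied to each Jordan block: $f(J_s(\lambda))$ is the $s\times s$ upper triangular Toeplitz matrix with $f^{(j)}(\lambda)/j!$ on the $j$-th superdiagonal, $0\le j\le s-1$. A generalized matrix sign function $\sigma:\mathbb{K}^{n\times n}\to\mathbb{K}^{n\times n}$ is a primary matrix function such that for all nonsingular $A\in\mathbb{K}^{n\times n}$: $\sigma(A)A$ has no eigenvalues on the negative real axis, $\sigma(\bar A)=\overline{\sigma(A)}$, and all eigenvalues $\lambda$ of $\sigma(A)$ satisfy $|\lambda|=1$. Such $\sigma$ is defined on nonsingular matrices only (the stem function is left undefined at $0$). *)

theory Defs
  imports
    "Jordan_Normal_Form.Jordan_Normal_Form"
    "Jordan_Normal_Form.Gauss_Jordan_Elimination"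
begin

(* The field is encoded as a set K of complex numbers, either \<real> or UNIV. Real matrices are
   thus complex matrices with real entries, and eigenvalues and Jordan decompositions are
   always taken over the complex numbers. *)

definition mats :: "complex set \<Rightarrow> nat \<Rightarrow> complex mat set" where
  "mats K n = {A \<in> carrier_mat n n. elements_mat A \<subseteq> K}"

(* mat_inverse returns an option; mat_inv is only meaningful on invertible matrices. *)
definition mat_inv :: "complex mat \<Rightarrow> complex mat" where
  "mat_inv A = the (mat_inverse A)"

(* The form is x^T N y (Bilinear) or (conjugate of x)^T N y (Sesquilinear). *)
datatype form_kind = Bilinear | Sesquilinear

fun star :: "form_kind \<Rightarrow> complex mat \<Rightarrow> complex mat" where
  "star Bilinear A = transpose_mat A"
| "star Sesquilinear A = transpose_mat (map_mat cnj A)"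

definition adj2 :: "form_kind \<Rightarrow> complex mat \<Rightarrow> complex mat \<Rightarrow> complex mat \<Rightarrow> complex mat" where
  "adj2 k M N A = mat_inv N * star k A * M"

definition adj :: "form_kind \<Rightarrow> complex mat \<Rightarrow> complex mat \<Rightarrow> complex mat" where
  "adj k N A = mat_inv N * star k A * N"

definition selfadjoint :: "form_kind \<Rightarrow> complex mat \<Rightarrow> complex mat \<Rightarrow> bool" where
  "selfadjoint k N A \<longleftrightarrow> adj k N A = A"

definition unitary2 :: "form_kind \<Rightarrow> complex mat \<Rightarrow> complex mat \<Rightarrow> complex mat \<Rightarrow> bool" where
  "unitary2 k M N W \<longleftrightarrow>
     adj2 k M N W * W = 1\<^sub>m (dim_row W) \<and> W * adj2 k M N W = 1\<^sub>m (dim_row W)"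

definition r_positive_definite :: "complex mat \<Rightarrow> bool" where
  "r_positive_definite A \<longleftrightarrow> (\<forall>l. eigenvalue A l \<longrightarrow> Re l > 0)"

(* Meaningful for A without eigenvalues in the closed negative real axis. *)
definition principal_sqrt :: "complex mat \<Rightarrow> complex mat" where
  "principal_sqrt A = (THE X. X \<in> carrier_mat (dim_row A) (dim_row A) \<and> X * X = A \<and>
     (\<forall>l. eigenvalue X l \<longrightarrow> Re l > 0))"

(* A stem function is f :: complex => nat => complex, where f l j is the (arbitrarily
   assigned) value of the j-th "derivative" at l. It is applied to a Jordan block of size s with
   eigenvalue l, and to a Jordan matrix given by its list of (size, eigenvalue) pairs. *)

definition stem_jordan_block :: "(complex \<Rightarrow> nat \<Rightarrow> complex) \<Rightarrow> nat \<Rightarrow> complex \<Rightarrow> complex mat" where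
  "stem_jordan_block f s l =
     mat s s (\<lambda>(i, j). if i \<le> j then f l (j - i) / fact (j - i) else 0)"

definition stem_jordan_matrix ::
    "(complex \<Rightarrow> nat \<Rightarrow> complex) \<Rightarrow> (nat \<times> complex) list \<Rightarrow> complex mat" where
  "stem_jordan_matrix f n_as = diag_block_mat (map (\<lambda>(s, l). stem_jordan_block f s l) n_as)"

(* B = f(A) for the primary matrix function of f; B does not depend on the choice of the
   Jordan decomposition A = P J Q with Q the inverse of P. *)
definition primary_value ::
    "(complex \<Rightarrow> nat \<Rightarrow> complex) \<Rightarrow> complex mat \<Rightarrow> complex mat \<Rightarrow> bool" where
  "primary_value f A B \<longleftrightarrow> (\<exists>n_as P Q. 0 \<notin> fst ` set n_as \<and>
     similar_mat_wit A (jordan_matrix n_as) P Q \<and> B = P * stem_jordan_matrix f n_as * Q)"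

(* Only nonsingular arguments are constrained, so neither the value of \<sigma> at singular matrices
   nor that of the stem function at 0 plays any role. *)
definition generalized_sign_function ::
    "complex set \<Rightarrow> nat \<Rightarrow> (complex mat \<Rightarrow> complex mat) \<Rightarrow> bool" where
  "generalized_sign_function K n \<sigma> \<longleftrightarrow>
     (\<exists>f. \<forall>A \<in> mats K n. invertible_mat A \<longrightarrow> primary_value f A (\<sigma> A)) \<and>
     (\<forall>A \<in> mats K n. invertible_mat A \<longrightarrow>
        \<sigma> A \<in> mats K n \<and>
        (\<forall>l. eigenvalue (\<sigma> A * A) l \<longrightarrow> \<not> (l \<in> \<real> \<and> Re l < 0)) \<and>
        \<sigma> (map_mat cnj A) = map_mat cnj (\<sigma> A) \<and>
        (\<forall>l. eigenvalue (\<sigma> A) l \<longrightarrow> cmod l = 1))"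

definition right_decomposition ::
    "complex set \<Rightarrow> nat \<Rightarrow> form_kind \<Rightarrow> complex mat \<Rightarrow> (complex mat \<Rightarrow> complex mat) \<Rightarrow>
     complex mat \<Rightarrow> complex mat \<Rightarrow> complex mat \<Rightarrow> bool" where
  "right_decomposition K n k N \<sigma> F W S \<longleftrightarrow>
     (let \<Sigma> = \<sigma> (adj k N F * F) in
       W \<in> mats K n \<and> S \<in> mats K n \<and> F = W * S \<and>
       unitary2 k N (N * mat_inv \<Sigma>) W \<and> adj k N (adj k N W) = W \<and>
       r_positive_definite S \<and> selfadjoint k N S \<and> selfadjoint k (N * \<Sigma>) S)"

definition left_decomposition ::
    "complex set \<Rightarrow> nat \<Rightarrow> form_kind \<Rightarrow> complex mat \<Rightarrow> (complex mat \<Rightarrow> complex mat) \<Rightarrow>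
     complex mat \<Rightarrow> complex mat \<Rightarrow> complex mat \<Rightarrow> bool" where
  "left_decomposition K n k N \<sigma> F S W \<longleftrightarrow>
     (let \<Sigma> = \<sigma> (F * adj k N F) in
       S \<in> mats K n \<and> W \<in> mats K n \<and> F = S * W \<and>
       r_positive_definite S \<and> selfadjoint k N S \<and> selfadjoint k (N * \<Sigma>) S \<and>
       unitary2 k (N * \<Sigma>) N W)"

end

(* Since F F^[N] = F (F^[N] F) F^-1 and primary matrix functions respect similarity,
   Sigma' = F Sigma F^-1 = W Sigma W^-1. Hence F = W S = (W S W^-1) W is a left decomposition:
   W^[N] = Sigma^-1 W^-1 turns all the required properties of W S W^-1 and W into
   properties of S. Conversely, in any left decomposition S' commutes with Sigma' and
   W' W'^[N] = Sigma'^-1, so S'^2 = Sigma' F F^[N]. A square root with spectrum in the open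
   right half-plane is unique, because the difference of two such roots solves a Sylvester
   equation with disjoint spectra; this gives uniqueness and W' = W.
   That primary functions respect similarity follows from the fact that a matrix intertwining two
   Jordan matrices also intertwines their stem images, which is checked block by block. *)

theory Submission
  imports Defs "Jordan_Normal_Form.Schur_Decomposition"
begin

subsection \<open>Sylvester equations and square roots\<close>

text \<open>Similar matrices share their characteristic polynomial, and that of a triangular matrix
  is the product of the linear factors at its diagonal entries.\<close>

lemma diag_eigenvalue_of_similar_triangular:
  fixes B T :: "'a :: field mat"
  assumes T: "T \<in> carrier_mat m m" "upper_triangular T" and sim: "similar_mat B T" and j: "j < m"
  shows "eigenvalue B (T $$ (j, j))"
proof -
  have B: "B \<in> carrier_mat m m"
    using similar_matD[OF sim] T(1) by (metis carrier_matD(1) insert_subset)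
  have "T $$ (j, j) \<in> set (diag_mat T)" using T(1) j unfolding diag_mat_def by auto
  hence "poly (\<Prod>a\<leftarrow>diag_mat T. [:- a, 1:]) (T $$ (j, j)) = 0"
    by (force simp: poly_prod_list prod_list_zero_iff)
  hence "poly (char_poly T) (T $$ (j, j)) = 0" using char_poly_upper_triangular[OF T] by metis
  thus ?thesis
    unfolding eigenvalue_root_char_poly[OF B] char_poly_similar[OF sim] .
qed

text \<open>After triangularising \<open>B\<close>, the first nonzero column of \<open>X\<close> would be an eigenvector of \<open>A\<close>
  for a diagonal entry of the triangular form.\<close>
lemma sylvester_unique:
  fixes A B X :: "complex mat"
  assumes A: "A \<in> carrier_mat n n" and B: "B \<in> carrier_mat m m" and X: "X \<in> carrier_mat n m"
    and eq: "A * X = X * B"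
    and disj: "\<And>l. eigenvalue A l \<Longrightarrow> eigenvalue B l \<Longrightarrow> False"
  shows "X = 0\<^sub>m n m"
proof -
  obtain es where "char_poly B = (\<Prod> a \<leftarrow> es. [:- a, 1:])"
    using char_poly_factorized[OF B] by blast
  from schur_decomposition_exists[OF B this] obtain T where
    T: "T \<in> carrier_mat m m" "upper_triangular T" and sim: "similar_mat B T" by blast
  from sim obtain P Q where "similar_mat_wit B T P Q" unfolding similar_mat_def by blast
  note w = similar_mat_witD2[OF B this]
  define Y where "Y = X * P"
  have Y: "Y \<in> carrier_mat n m" using X w unfolding Y_def by auto
  have BP: "B * P = P * T"
  proof -
    have "B * P = (P * T) * (Q * P)"
      unfolding w(3) using w(5-7) by (simp add: assoc_mult_mat[of _ m m _ m _ m])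
    thus ?thesis using w(2,5,6) by simp
  qed
  have "A * Y = (A * X) * P" unfolding Y_def using assoc_mult_mat[OF A X w(6)] by simp
  also have "\<dots> = X * (B * P)" unfolding eq using assoc_mult_mat[OF X B w(6)] by simp
  also have "\<dots> = Y * T"
    unfolding BP Y_def using assoc_mult_mat[OF X w(6) T(1)] by simp
  finally have AY: "A * Y = Y * T" .
  have col0: "\<forall>i<n. Y $$ (i, j) = 0" if "j < m" for j
    using that
  proof (induction j rule: less_induct)
    case (less j)
    show ?case
    proof (rule ccontr)
      assume "\<not> ?thesis"
      then obtain i0 where i0: "i0 < n" "Y $$ (i0, j) \<noteq> 0" by blast
      have "A *\<^sub>v col Y j = T $$ (j, j) \<cdot>\<^sub>v col Y j"
      proof (rule eq_vecI)
        fix i assume "i < dim_vec (T $$ (j, j) \<cdot>\<^sub>v col Y j)"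
        hence i: "i < n" using Y by simp
        have "(A *\<^sub>v col Y j) $ i = (A * Y) $$ (i, j)" using i A Y less.prems by simp
        also have "\<dots> = (\<Sum>l<m. Y $$ (i, l) * T $$ (l, j))"
          unfolding AY using i Y T less.prems by (simp add: scalar_prod_def lessThan_atLeast0)
        \<comment> \<open>Only \<open>l = j\<close> survives: the columns \<open>l < j\<close> of
          \<open>Y\<close> vanish by the induction hypothesis, and the entries of \<open>T\<close>
          with \<open>l > j\<close> vanish by triangularity.\<close>
        also have "\<dots> = (\<Sum>l<m. if l = j then Y $$ (i, j) * T $$ (j, j) else 0)"
        proof (rule sum.cong[OF refl])
          fix l assume l: "l \<in> {..<m}"
          show "Y $$ (i, l) * T $$ (l, j) = (if l = j then Y $$ (i, j) * T $$ (j, j) else 0)"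
            using less.IH[of l] i l T upper_triangularD[OF T(2), of j l]
            by (cases l j rule: linorder_cases) auto
        qed
        also have "\<dots> = Y $$ (i, j) * T $$ (j, j)" using less.prems by simp
        finally show "(A *\<^sub>v col Y j) $ i = (T $$ (j, j) \<cdot>\<^sub>v col Y j) $ i"
          using i Y less.prems by simp
      qed (use A Y in simp)
      moreover have "col Y j \<noteq> 0\<^sub>v n"
      proof
        assume "col Y j = 0\<^sub>v n"
        hence "col Y j $ i0 = 0" using i0 by simp
        thus False using i0 Y less.prems by simp
      qed
      ultimately have "eigenvalue A (T $$ (j, j))"
        unfolding eigenvalue_def eigenvector_def using A Y by (intro exI[of _ "col Y j"]) auto
      moreover have "eigenvalue B (T $$ (j, j))"
        by (rule diag_eigenvalue_of_similar_triangular[OF T sim less.prems])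
      ultimately show False by (rule disj)
    qed
  qed
  have "Y = 0\<^sub>m n m" using Y col0 by (intro eq_matI) auto
  moreover have "X = Y * Q"
    unfolding Y_def using assoc_mult_mat[OF X w(6,7)] w(1) X by simp
  ultimately show ?thesis using w(7) by simp
qed

text \<open>Places the spectrum of the negative of a right half-plane root in the left half-plane,
  which gives the disjoint spectra for the Sylvester equation below.\<close>

lemma eigenvalue_uminus:
  fixes A :: "'a :: comm_ring_1 mat"
  assumes A: "A \<in> carrier_mat n n" and ev: "eigenvalue (- A) l"
  shows "eigenvalue A (- l)"
proof -
  obtain v where v: "v \<in> carrier_vec n" "v \<noteq> 0\<^sub>v n" "(- A) *\<^sub>v v = l \<cdot>\<^sub>v v"
    using ev A unfolding eigenvalue_def eigenvector_def by auto
  have "A *\<^sub>v v = (- l) \<cdot>\<^sub>v v"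
  proof (rule eq_vecI)
    fix i assume "i < dim_vec ((- l) \<cdot>\<^sub>v v)"
    hence i: "i < n" using v by simp
    have "- ((A *\<^sub>v v) $ i) = ((- A) *\<^sub>v v) $ i" using A v(1) i by simp
    also have "\<dots> = l * v $ i" unfolding v(3) using v(1) i by simp
    finally have "(A *\<^sub>v v) $ i = - (l * v $ i)" by (simp add: minus_equation_iff)
    thus "(A *\<^sub>v v) $ i = ((- l) \<cdot>\<^sub>v v) $ i" using i v(1) by simp
  qed (use A v in simp)
  thus ?thesis unfolding eigenvalue_def eigenvector_def using A v by auto
qed

text \<open>The difference \<open>Z = X - Y\<close> of two square roots satisfies \<open>X * Z = Z * (- Y)\<close>.\<close>
lemma square_root_unique:
  fixes X Y :: "complex mat"
  assumes X: "X \<in> carrier_mat n n" and Y: "Y \<in> carrier_mat n n" and eq: "X * X = Y * Y"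
    and pX: "\<And>l. eigenvalue X l \<Longrightarrow> Re l > 0" and pY: "\<And>l. eigenvalue Y l \<Longrightarrow> Re l > 0"
  shows "X = Y"
proof -
  have "X * (X - Y) = Y * Y - X * Y"
    using mult_minus_distrib_mat[OF X X Y] eq by simp
  also have "\<dots> = (X - Y) * (- Y)"
    using minus_mult_distrib_mat[OF X Y, of "- Y" n] X Y
    by (simp, intro eq_matI) auto
  finally have "X * (X - Y) = (X - Y) * (- Y)" .
  moreover have False if "eigenvalue X l" "eigenvalue (- Y) l" for l
    using pX[OF that(1)] pY[OF eigenvalue_uminus[OF Y that(2)]] by simp
  ultimately have "X - Y = 0\<^sub>m n n"
    using X Y by (intro sylvester_unique[of X n "- Y" n "X - Y"]) auto
  show ?thesis
  proof (rule eq_matI)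
    fix i j assume ij: "i < dim_row Y" "j < dim_col Y"
    have "(X - Y) $$ (i, j) = 0" using \<open>X - Y = 0\<^sub>m n n\<close> ij Y by simp
    thus "X $$ (i, j) = Y $$ (i, j)" using ij X Y by simp
  qed (use X Y in auto)
qed

text \<open>Exhibiting one root with spectrum in the open right half-plane settles existence in the
  definite description; \<open>square_root_unique\<close> settles uniqueness.\<close>

lemma principal_sqrt_eqI:
  assumes X: "X \<in> carrier_mat n n" and "X * X = A" and "r_positive_definite X"
  shows "principal_sqrt A = X"
proof -
  have A: "dim_row A = n" using assms(1,2) by auto
  show ?thesis
    unfolding principal_sqrt_def A
  proof (rule the_equality)
    show "X \<in> carrier_mat n n \<and> X * X = A \<and> (\<forall>l. eigenvalue X l \<longrightarrow> Re l > 0)"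
      using assms unfolding r_positive_definite_def by blast
  next
    fix Y assume Y: "Y \<in> carrier_mat n n \<and> Y * Y = A \<and> (\<forall>l. eigenvalue Y l \<longrightarrow> Re l > 0)"
    hence "Y * Y = X * X" using assms(2) by simp
    thus "Y = X"
      using Y assms(3) square_root_unique[OF _ X] unfolding r_positive_definite_def by blast
  qed
qed

subsection \<open>Primary matrix functions\<close>

lemma stem_jordan_block_dim [simp]:
  "dim_row (stem_jordan_block f s l) = s" "dim_col (stem_jordan_block f s l) = s"
  "stem_jordan_block f s l \<in> carrier_mat s s"
  by (auto simp: stem_jordan_block_def)

lemma stem_jordan_matrix_dim [simp]:
  "dim_row (stem_jordan_matrix f n_as) = sum_list (map fst n_as)"
  "dim_col (stem_jordan_matrix f n_as) = sum_list (map fst n_as)"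
  by (induction n_as) (auto simp: stem_jordan_matrix_def Let_def)

text \<open>Entrywise form of a power rule: if \<open>X\<close> intertwines the nilpotent shifts of
  sizes \<open>s\<close> and \<open>t\<close>, it intertwines their \<open>k\<close>-th powers. On
  the left a shift moves rows up, on the right it moves columns to the right.\<close>

lemma nilpotent_shift_intertwine:
  fixes X :: "nat \<Rightarrow> nat \<Rightarrow> 'a :: zero"
  assumes base: "\<And>i j. i < s \<Longrightarrow> j < t \<Longrightarrow>
      (if Suc i < s then X (Suc i) j else 0) = (if 1 \<le> j then X i (j - 1) else 0)"
    and "i < s" "j < t"
  shows "(if i + k < s then X (i + k) j else 0) = (if k \<le> j then X i (j - k) else 0)"
  using assms(2,3)
proof (induction k arbitrary: i)
  case (Suc k)
  \<comment> \<open>The induction hypothesis is used in row \<open>Suc i\<close>, and this relation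
    then lowers the column from \<open>j - k\<close> once more. For \<open>j \<le> k\<close> the
    difference truncates to 0 and the right side is 0, as the claim for \<open>Suc k\<close>
    requires.\<close>
  have b: "(if Suc i < s then X (Suc i) (j - k) else 0) =
      (if 1 \<le> j - k then X i (j - k - 1) else 0)"
    using base[of i "j - k"] Suc.prems by simp
  show ?case
  proof (cases "Suc i < s")
    case True
    with b Suc.IH[OF True Suc.prems(2)] show ?thesis
      by (cases "k < j") (auto split: if_splits)
  next
    case False
    with b Suc.prems show ?thesis by (cases "k < j") (auto split: if_splits)
  qed
qed simp

lemma jordan_block_mult_left:
  fixes X :: "'a :: comm_ring_1 mat"
  assumes X: "X \<in> carrier_mat s t" and i: "i < s" and j: "j < t"
  shows "(jordan_block s l * X) $$ (i, j) =
    l * X $$ (i, j) + (if Suc i < s then X $$ (Suc i, j) else 0)"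
proof -
  have "(jordan_block s l * X) $$ (i, j) = (\<Sum>r<s. jordan_block s l $$ (i, r) * X $$ (r, j))"
    using X i j by (simp add: scalar_prod_def lessThan_atLeast0)
  also have "\<dots> =
      (\<Sum>r<s. (if r = i then l * X $$ (i, j) else 0) + (if r = Suc i then X $$ (Suc i, j) else 0))"
    using i by (intro sum.cong) auto
  finally show ?thesis using i by (simp add: sum.distrib)
qed

lemma jordan_block_mult_right:
  fixes X :: "'a :: comm_ring_1 mat"
  assumes X: "X \<in> carrier_mat s t" and i: "i < s" and j: "j < t"
  shows "(X * jordan_block t l) $$ (i, j) =
    l * X $$ (i, j) + (if 1 \<le> j then X $$ (i, j - 1) else 0)"
proof -
  have "(X * jordan_block t l) $$ (i, j) = (\<Sum>r<t. X $$ (i, r) * jordan_block t l $$ (r, j))"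
    using X i j by (simp add: scalar_prod_def lessThan_atLeast0)
  \<comment> \<open>The inner guard matters for \<open>j = 0\<close>, where the truncated
    \<open>j - 1\<close> equals \<open>j\<close> and no superdiagonal entry exists.\<close>
  also have "\<dots> =
      (\<Sum>r<t. (if r = j then l * X $$ (i, j) else 0) +
        (if r = j - 1 then if 1 \<le> j then X $$ (i, j - 1) else 0 else 0))"
    using j by (intro sum.cong) auto
  finally show ?thesis using j by (auto simp: sum.distrib)
qed

text \<open>The stem block is the polynomial in the nilpotent shift whose \<open>k\<close>-th
  coefficient is \<open>f l k / fact k\<close>. The range \<open>k < s + t\<close> is padded with
  vanishing terms so that left and right products are sums over the same index set.\<close>

lemma stem_jordan_block_mult_left:
  assumes X: "X \<in> carrier_mat s t" and i: "i < s" and j: "j < t"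
  shows "(stem_jordan_block f s l * X) $$ (i, j) =
    (\<Sum>k<s + t. f l k / fact k * (if i + k < s then X $$ (i + k, j) else 0))"
proof -
  have "(stem_jordan_block f s l * X) $$ (i, j) =
      (\<Sum>r<s. if i \<le> r then f l (r - i) / fact (r - i) * X $$ (r, j) else 0)"
    using X i j by (auto simp: stem_jordan_block_def scalar_prod_def lessThan_atLeast0 intro!: sum.cong)
  also have "\<dots> = (\<Sum>r\<in>{i..<s}. f l (r - i) / fact (r - i) * X $$ (r, j))"
    by (intro sum.mono_neutral_cong_right) auto
  also have "\<dots> = (\<Sum>k<s - i. f l k / fact k * X $$ (i + k, j))"
    using i by (intro sum.reindex_bij_witness[of _ "\<lambda>k. i + k" "\<lambda>r. r - i"]) auto
  also have "\<dots> = (\<Sum>k<s + t. f l k / fact k * (if i + k < s then X $$ (i + k, j) else 0))"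
    by (intro sum.mono_neutral_cong_left) auto
  finally show ?thesis .
qed

lemma stem_jordan_block_mult_right:
  assumes X: "X \<in> carrier_mat s t" and i: "i < s" and j: "j < t"
  shows "(X * stem_jordan_block f t l) $$ (i, j) =
    (\<Sum>k<s + t. f l k / fact k * (if k \<le> j then X $$ (i, j - k) else 0))"
proof -
  have "(X * stem_jordan_block f t l) $$ (i, j) =
      (\<Sum>r<t. if r \<le> j then f l (j - r) / fact (j - r) * X $$ (i, r) else 0)"
    using X i j by (auto simp: stem_jordan_block_def scalar_prod_def lessThan_atLeast0 intro!: sum.cong)
  also have "\<dots> = (\<Sum>r\<in>{..j}. f l (j - r) / fact (j - r) * X $$ (i, r))"
    using j by (intro sum.mono_neutral_cong_right) auto
  also have "\<dots> = (\<Sum>k\<in>{..j}. f l k / fact k * X $$ (i, j - k))"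
    by (intro sum.reindex_bij_witness[of _ "\<lambda>k. j - k" "\<lambda>r. j - r"]) auto
  also have "\<dots> = (\<Sum>k<s + t. f l k / fact k * (if k \<le> j then X $$ (i, j - k) else 0))"
    using j by (intro sum.mono_neutral_cong_left) auto
  finally show ?thesis .
qed

text \<open>For distinct eigenvalues the Sylvester lemma forces \<open>X = 0\<close>. For equal ones
  the scalar parts cancel, so \<open>X\<close> intertwines the shifts, hence all their powers, and
  the two stem products agree term by term.\<close>

lemma stem_jordan_block_intertwine:
  assumes X: "X \<in> carrier_mat s t" and eq: "jordan_block s a * X = X * jordan_block t b"
  shows "stem_jordan_block f s a * X = X * stem_jordan_block f t b"
proof (cases "a = b")
  case False
  have ev: "l = c" if "eigenvalue (jordan_block r c) l" for r and c l :: complex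
    using that unfolding eigenvalue_root_char_poly[OF jordan_block_carrier] jordan_block_char_poly
    by simp
  have "X = 0\<^sub>m s t"
    using sylvester_unique[OF jordan_block_carrier jordan_block_carrier X eq] ev False by blast
  thus ?thesis by (simp add: left_mult_zero_mat[of _ t] right_mult_zero_mat[of _ s s])
next
  case True
  have shift: "(if i + k < s then X $$ (i + k, j) else 0) = (if k \<le> j then X $$ (i, j - k) else 0)"
    if "i < s" "j < t" for i j k
  proof (rule nilpotent_shift_intertwine[where X = "\<lambda>i j. X $$ (i, j)" and t = t])
    fix i j assume ij: "i < s" "j < t"
    show "(if Suc i < s then X $$ (Suc i, j) else 0) = (if 1 \<le> j then X $$ (i, j - 1) else 0)"
      using arg_cong[OF eq, of "\<lambda>M. M $$ (i, j)"] True
      unfolding jordan_block_mult_left[OF X ij] jordan_block_mult_right[OF X ij] by simp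
  qed (use that in auto)
  show ?thesis
  proof (rule eq_matI)
    fix i j
    assume "i < dim_row (X * stem_jordan_block f t b)" "j < dim_col (X * stem_jordan_block f t b)"
    hence ij: "i < s" "j < t" using X by auto
    show "(stem_jordan_block f s a * X) $$ (i, j) = (X * stem_jordan_block f t b) $$ (i, j)"
      unfolding stem_jordan_block_mult_left[OF X ij] stem_jordan_block_mult_right[OF X ij] True
      using shift[OF ij] by simp
  qed (use X in auto)
qed

section \<open>From single Jordan blocks to Jordan matrices\<close>

lemma sum_lessThan_add: "(\<Sum>l<s + r. g l) = (\<Sum>l<s. g l) + (\<Sum>l<r. g (s + l))"
  for g :: "nat \<Rightarrow> 'a :: comm_monoid_add"
  by (induction r) (auto simp: ac_simps)

lemma mult_mat_index_sum:
  assumes "A \<in> carrier_mat p q" "B \<in> carrier_mat q r" "i < p" "j < r"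
  shows "(A * B) $$ (i, j) = (\<Sum>l<q. A $$ (i, l) * B $$ (l, j))"
  using assms by (simp add: scalar_prod_def lessThan_atLeast0)

text \<open>A block diagonal left factor acts separately on the upper and lower rows of
  \<open>X\<close>, and right multiplication by \<open>B\<close> acts row by row. The equivalence
  serves both to split an intertwining relation and to reassemble one.\<close>

lemma block_diag_mult_eq_iff:
  fixes A1 :: "'a :: comm_semiring_1 mat"
  assumes A1: "A1 \<in> carrier_mat s s" and A2: "A2 \<in> carrier_mat r r"
    and X1: "X1 \<in> carrier_mat s m" and X2: "X2 \<in> carrier_mat r m" and B: "B \<in> carrier_mat m m"
    and X: "X = mat (s + r) m (\<lambda>(i, j). if i < s then X1 $$ (i, j) else X2 $$ (i - s, j))"
  shows "four_block_mat A1 (0\<^sub>m s r) (0\<^sub>m r s) A2 * X = X * B \<longleftrightarrow>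
    A1 * X1 = X1 * B \<and> A2 * X2 = X2 * B"
proof -
  let ?D = "four_block_mat A1 (0\<^sub>m s r) (0\<^sub>m r s) A2"
  have D: "?D \<in> carrier_mat (s + r) (s + r)" using A1 A2 by simp
  have Xc: "X \<in> carrier_mat (s + r) m" unfolding X by simp
  have l1: "(?D * X) $$ (i, j) = (A1 * X1) $$ (i, j)" if "i < s" "j < m" for i j
  proof -
    have "(?D * X) $$ (i, j) = (\<Sum>l<s + r. ?D $$ (i, l) * X $$ (l, j))"
      using mult_mat_index_sum[OF D Xc] that by simp
    also have "\<dots> = (\<Sum>l<s. A1 $$ (i, l) * X1 $$ (l, j))"
      unfolding sum_lessThan_add using A1 A2 that by (simp add: X)
    finally show ?thesis using mult_mat_index_sum[OF A1 X1] that by simp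
  qed
  have l2: "(?D * X) $$ (s + i, j) = (A2 * X2) $$ (i, j)" if "i < r" "j < m" for i j
  proof -
    have "(?D * X) $$ (s + i, j) = (\<Sum>l<s + r. ?D $$ (s + i, l) * X $$ (l, j))"
      using mult_mat_index_sum[OF D Xc] that by simp
    also have "\<dots> = (\<Sum>l<r. A2 $$ (i, l) * X2 $$ (l, j))"
      unfolding sum_lessThan_add using A1 A2 that by (simp add: X)
    finally show ?thesis using mult_mat_index_sum[OF A2 X2] that by simp
  qed
  have r1: "(X * B) $$ (i, j) = (X1 * B) $$ (i, j)" if "i < s" "j < m" for i j
    using mult_mat_index_sum[OF Xc B] mult_mat_index_sum[OF X1 B] that by (simp add: X)
  have r2: "(X * B) $$ (s + i, j) = (X2 * B) $$ (i, j)" if "i < r" "j < m" for i j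
    using mult_mat_index_sum[OF Xc B] mult_mat_index_sum[OF X2 B] that by (simp add: X)
  show ?thesis
  proof (intro iffI conjI)
    assume eq: "?D * X = X * B"
    \<comment> \<open>Entries of products stay folded, so that \<open>l1\<close> and
      \<open>r1\<close> can be read backwards and \<open>eq\<close> applies to the whole
      product.\<close>
    show "A1 * X1 = X1 * B"
      using A1 X1 B eq by (intro eq_matI) (auto simp del: index_mult_mat(1) simp: l1[symmetric] r1[symmetric])
    show "A2 * X2 = X2 * B"
      using A2 X2 B eq by (intro eq_matI) (auto simp del: index_mult_mat(1) simp: l2[symmetric] r2[symmetric])
  next
    assume eq: "A1 * X1 = X1 * B \<and> A2 * X2 = X2 * B"
    show "?D * X = X * B"
    proof (rule eq_matI)
      fix i j assume "i < dim_row (X * B)" "j < dim_col (X * B)"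
      hence ij: "i < s + r" "j < m" using Xc B by auto
      show "(?D * X) $$ (i, j) = (X * B) $$ (i, j)"
      proof (cases "i < s")
        case True
        thus ?thesis using l1 r1 eq ij by simp
      next
        case False
        thus ?thesis using l2[of "i - s" j] r2[of "i - s" j] eq ij by simp
      qed
    qed (use D Xc B in auto)
  qed
qed

lemma transpose_block_diag:
  assumes "A1 \<in> carrier_mat s s" "A2 \<in> carrier_mat r r"
  shows "transpose_mat (four_block_mat A1 (0\<^sub>m s r) (0\<^sub>m r s) A2) =
    four_block_mat (transpose_mat A1) (0\<^sub>m s r) (0\<^sub>m r s) (transpose_mat A2)"
  using transpose_four_block_mat[OF assms(1) zero_carrier_mat zero_carrier_mat assms(2)] by simp

lemma stem_jordan_matrix_carrier [simp]:
  "stem_jordan_matrix f n_as \<in> carrier_mat (sum_list (map fst n_as)) (sum_list (map fst n_as))"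
  by (intro carrier_matI) auto

lemma jordan_matrix_Cons_block:
  "jordan_matrix ((s, a) # n_as) = four_block_mat (jordan_block s a)
    (0\<^sub>m s (sum_list (map fst n_as))) (0\<^sub>m (sum_list (map fst n_as)) s) (jordan_matrix n_as)"
  using jordan_matrix_dim[of n_as] unfolding jordan_matrix_def by (simp add: Let_def)

lemma stem_jordan_matrix_Cons_block:
  "stem_jordan_matrix f ((s, a) # n_as) = four_block_mat (stem_jordan_block f s a)
    (0\<^sub>m s (sum_list (map fst n_as))) (0\<^sub>m (sum_list (map fst n_as)) s) (stem_jordan_matrix f n_as)"
  using stem_jordan_matrix_dim[of f n_as] unfolding stem_jordan_matrix_def by (simp add: Let_def)

text \<open>Induction step for adding one diagonal block; the primed matrices stand for stem images.
  It serves row blocks directly and column blocks after transposition.\<close>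

lemma intertwine_block_diag:
  fixes A1 :: "'a :: comm_semiring_1 mat"
  assumes A1: "A1 \<in> carrier_mat s s" "A1' \<in> carrier_mat s s"
    and A2: "A2 \<in> carrier_mat r r" "A2' \<in> carrier_mat r r"
    and B: "B \<in> carrier_mat m m" "B' \<in> carrier_mat m m"
    and imp1: "\<And>X. X \<in> carrier_mat s m \<Longrightarrow> A1 * X = X * B \<Longrightarrow> A1' * X = X * B'"
    and imp2: "\<And>X. X \<in> carrier_mat r m \<Longrightarrow> A2 * X = X * B \<Longrightarrow> A2' * X = X * B'"
    and X: "X \<in> carrier_mat (s + r) m"
    and eq: "four_block_mat A1 (0\<^sub>m s r) (0\<^sub>m r s) A2 * X = X * B"
  shows "four_block_mat A1' (0\<^sub>m s r) (0\<^sub>m r s) A2' * X = X * B'"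
proof -
  define X1 where "X1 = mat s m (\<lambda>(i, j). X $$ (i, j))"
  define X2 where "X2 = mat r m (\<lambda>(i, j). X $$ (s + i, j))"
  have c: "X1 \<in> carrier_mat s m" "X2 \<in> carrier_mat r m" unfolding X1_def X2_def by auto
  have Xeq: "X = mat (s + r) m (\<lambda>(i, j). if i < s then X1 $$ (i, j) else X2 $$ (i - s, j))"
    using X unfolding X1_def X2_def by (intro eq_matI) auto
  from eq have "A1 * X1 = X1 * B \<and> A2 * X2 = X2 * B"
    unfolding block_diag_mult_eq_iff[OF A1(1) A2(1) c B(1) Xeq] .
  hence "A1' * X1 = X1 * B' \<and> A2' * X2 = X2 * B'" using imp1 imp2 c by blast
  thus ?thesis unfolding block_diag_mult_eq_iff[OF A1(2) A2(2) c B(2) Xeq] .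
qed

text \<open>Induction on the list of blocks. \<open>B\<close> and \<open>B'\<close> are kept
  arbitrary so that they can later be a whole Jordan matrix and its stem image.\<close>

lemma intertwine_jordan_left:
  assumes B: "B \<in> carrier_mat m m" "B' \<in> carrier_mat m m"
    and imp: "\<And>s a X. X \<in> carrier_mat s m \<Longrightarrow> jordan_block s a * X = X * B \<Longrightarrow>
      stem_jordan_block f s a * X = X * B'"
    and X: "X \<in> carrier_mat (sum_list (map fst n_as)) m"
    and eq: "jordan_matrix n_as * X = X * B"
  shows "stem_jordan_matrix f n_as * X = X * B'"
  using X eq
proof (induction n_as arbitrary: X)
  case Nil
  thus ?case using B by (intro eq_matI) (auto simp: stem_jordan_matrix_def)
next
  case (Cons sa n_as)
  obtain s a where sa: "sa = (s, a)" by force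
  show ?case
    unfolding sa stem_jordan_matrix_Cons_block
    by (rule intertwine_block_diag[OF jordan_block_carrier[of s a] _ jordan_matrix_carrier[of n_as] _ B
          imp Cons.IH])
      (use Cons.prems in \<open>auto simp: sa jordan_matrix_Cons_block\<close>)
qed

text \<open>Transposition exchanges the two sides of an intertwining relation, so splitting
  \<open>X\<close> by columns becomes the splitting by rows of
  \<open>intertwine_block_diag\<close>.\<close>

lemma intertwine_jordan_right:
  assumes imp: "\<And>s b X. X \<in> carrier_mat m s \<Longrightarrow> A * X = X * jordan_block s b \<Longrightarrow>
      A' * X = X * stem_jordan_block f s b"
    and A: "A \<in> carrier_mat m m" "A' \<in> carrier_mat m m"
    and X: "X \<in> carrier_mat m (sum_list (map fst n_bs))"
    and eq: "A * X = X * jordan_matrix n_bs"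
  shows "A' * X = X * stem_jordan_matrix f n_bs"
  using X eq
proof (induction n_bs arbitrary: X)
  case Nil
  thus ?case using A by (intro eq_matI) (auto simp: stem_jordan_matrix_def)
next
  case (Cons sb n_bs)
  obtain s b where sb: "sb = (s, b)" by force
  define r where "r = sum_list (map fst n_bs)"
  have tr: "transpose_mat Y * transpose_mat C = transpose_mat D * transpose_mat Y \<longleftrightarrow> C * Y = Y * D"
    if "C \<in> carrier_mat p p" "D \<in> carrier_mat q q" "Y \<in> carrier_mat p q" for C D Y :: "complex mat" and p q
    using transpose_mult[OF that(1,3)] transpose_mult[OF that(3,2)] by (metis transpose_transpose)
  \<comment> \<open>The assumed implication in transposed form, used once for the first block and
    once for the induction hypothesis.\<close>
  have imp': "transpose_mat D' * Y = Y * transpose_mat A'"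
    if "\<And>Z. Z \<in> carrier_mat m q \<Longrightarrow> A * Z = Z * D \<Longrightarrow> A' * Z = Z * D'"
      "D \<in> carrier_mat q q" "D' \<in> carrier_mat q q"
      "Y \<in> carrier_mat q m" "transpose_mat D * Y = Y * transpose_mat A" for D D' Y q
    using that(1)[of "transpose_mat Y"] that tr[OF A(1) that(2), of "transpose_mat Y"]
      tr[OF A(2) that(3), of "transpose_mat Y"] by auto
  have X: "X \<in> carrier_mat m (s + r)" using Cons.prems(1) by (simp add: sb r_def)
  have J: "jordan_matrix n_bs \<in> carrier_mat r r" "stem_jordan_matrix f n_bs \<in> carrier_mat r r"
    unfolding r_def by auto
  let ?D = "four_block_mat (jordan_block s b) (0\<^sub>m s r) (0\<^sub>m r s) (jordan_matrix n_bs)"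
  let ?D' = "four_block_mat (stem_jordan_block f s b) (0\<^sub>m s r) (0\<^sub>m r s) (stem_jordan_matrix f n_bs)"
  have Dc: "?D \<in> carrier_mat (s + r) (s + r)" "?D' \<in> carrier_mat (s + r) (s + r)" using J by auto
  have "A * X = X * ?D"
    using Cons.prems(2) unfolding sb jordan_matrix_Cons_block r_def .
  hence "transpose_mat ?D * transpose_mat X = transpose_mat X * transpose_mat A"
    using tr[OF A(1) Dc(1) X] by simp
  hence "transpose_mat ?D' * transpose_mat X = transpose_mat X * transpose_mat A'"
    unfolding transpose_block_diag[OF jordan_block_carrier J(1)]
      transpose_block_diag[OF stem_jordan_block_dim(3) J(2)]
    using X J A imp'[OF imp jordan_block_carrier stem_jordan_block_dim(3)]
      imp'[OF Cons.IH[folded r_def] J]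
    by (intro intertwine_block_diag[of "transpose_mat (jordan_block s b)" s
          "transpose_mat (stem_jordan_block f s b)" "transpose_mat (jordan_matrix n_bs)" r
          "transpose_mat (stem_jordan_matrix f n_bs)" "transpose_mat A" m "transpose_mat A'"]) auto
  hence "A' * X = X * ?D'" using tr[OF A(2) Dc(2) X] by simp
  thus ?case unfolding sb stem_jordan_matrix_Cons_block r_def .
qed

text \<open>Two passes: the left matrix is cut into blocks while the right one stays whole, then the
  right one is cut against a single block. What remains is
  \<open>stem_jordan_block_intertwine\<close>.\<close>

lemma stem_jordan_matrix_intertwine:
  assumes X: "X \<in> carrier_mat (sum_list (map fst n_as)) (sum_list (map fst n_bs))"
    and eq: "jordan_matrix n_as * X = X * jordan_matrix n_bs"
  shows "stem_jordan_matrix f n_as * X = X * stem_jordan_matrix f n_bs"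
proof (rule intertwine_jordan_left[OF _ _ _ X eq])
  fix s a X
  assume "X \<in> carrier_mat s (sum_list (map fst n_bs))"
    and "jordan_block s a * X = X * jordan_matrix n_bs"
  thus "stem_jordan_block f s a * X = X * stem_jordan_matrix f n_bs"
    by (intro intertwine_jordan_right[where A = "jordan_block s a" and m = s])
      (auto intro: stem_jordan_block_intertwine)
qed auto

text \<open>For Jordan decompositions \<open>A = P J Q\<close> and \<open>C = P' J' Q'\<close> with \<open>C T = T A\<close>, the matrix
  \<open>Q' T P\<close> intertwines \<open>J'\<close> and \<open>J\<close>. With \<open>T = 1\<close> this is independence of the decomposition.\<close>
lemma primary_value_intertwine:
  assumes A: "A \<in> carrier_mat n n" and C: "C \<in> carrier_mat n n" and T: "T \<in> carrier_mat n n"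
    and CT: "C * T = T * A"
    and pA: "primary_value f A B" and pC: "primary_value f C D"
  shows "D * T = T * B"
proof -
  obtain n_as P Q where wA: "similar_mat_wit A (jordan_matrix n_as) P Q"
    and B: "B = P * stem_jordan_matrix f n_as * Q"
    using pA unfolding primary_value_def by blast
  obtain n_cs P' Q' where wC: "similar_mat_wit C (jordan_matrix n_cs) P' Q'"
    and D: "D = P' * stem_jordan_matrix f n_cs * Q'"
    using pC unfolding primary_value_def by blast
  define J where "J = jordan_matrix n_as"
  define J' where "J' = jordan_matrix n_cs"
  define G where "G = stem_jordan_matrix f n_as"
  define G' where "G' = stem_jordan_matrix f n_cs"
  note a = similar_mat_witD2[OF A wA, folded J_def] and c = similar_mat_witD2[OF C wC, folded J'_def]
  have n: "sum_list (map fst n_as) = n" "sum_list (map fst n_cs) = n"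
    using a(5) c(5) unfolding J_def J'_def by auto
  have G: "G \<in> carrier_mat n n" "G' \<in> carrier_mat n n"
    using stem_jordan_matrix_carrier[of f n_as] stem_jordan_matrix_carrier[of f n_cs]
    unfolding G_def G'_def n by auto
  note assoc = assoc_mult_mat[where n\<^sub>1 = n and n\<^sub>2 = n and n\<^sub>3 = n and n\<^sub>4 = n]
  have cancel: "P * (Q * Z) = Z" "Q * (P * Z) = Z" "P' * (Q' * Z) = Z" "Q' * (P' * Z) = Z"
    if "Z \<in> carrier_mat n n" for Z
    using that a(1,2,6,7) c(1,2,6,7) assoc[of P Q Z] assoc[of Q P Z] assoc[of P' Q' Z] assoc[of Q' P' Z]
    by auto
  have "J' * (Q' * T * P) = Q' * (C * T) * P"
    unfolding c(3) using a(5-7) c(5-7) T by (simp add: assoc cancel)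
  also have "\<dots> = Q' * T * P * J"
    unfolding CT a(3) using a(2,5-7) c(5-7) T by (simp add: assoc)
  finally have "G' * (Q' * T * P) = Q' * T * P * G"
    unfolding J_def J'_def G_def G'_def using a(6) c(7) T
    by (intro stem_jordan_matrix_intertwine) (simp_all add: n)
  hence eq: "G' * (Q' * (T * P)) = Q' * (T * (P * G))"
    using a(6) c(7) T G by (simp add: assoc)
  \<comment> \<open>Inserting \<open>P * Q = 1\<close> after \<open>T\<close> produces the
    intertwiner \<open>Q' * T * P\<close>, across which \<open>eq\<close> moves the stem
    matrix.\<close>
  have "D * T = P' * (G' * (Q' * (T * P))) * Q"
    unfolding D G'_def[symmetric] using a(1,6,7) c(6,7) T G by (simp add: assoc)
  also have "\<dots> = T * B"
    unfolding eq B G_def[symmetric] using a(6,7) c(6,7) T G by (simp add: assoc cancel)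
  finally show ?thesis .
qed

subsection \<open>Inverses, adjoints and the field of entries\<close>

text \<open>An invertible matrix is a unit of \<open>ring_mat\<close>, and on units
  \<open>mat_inverse\<close> returns an actual inverse; so \<open>the\<close> is applied to a
  \<open>Some\<close>.\<close>

lemma mat_inv_props:
  assumes A: "A \<in> carrier_mat n n" and inv: "invertible_mat A"
  shows "mat_inv A \<in> carrier_mat n n" "A * mat_inv A = 1\<^sub>m n" "mat_inv A * A = 1\<^sub>m n"
proof -
  obtain B where AB: "A * B = 1\<^sub>m n" and BA: "B * A = 1\<^sub>m (dim_row B)"
    using inv A unfolding invertible_mat_def inverts_mat_def by auto
  \<comment> \<open>\<open>invertible_mat\<close> leaves the dimensions of \<open>B\<close> open;
    both are read off the column counts of the two identities.\<close>
  have B: "B \<in> carrier_mat n n"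
    using arg_cong[OF AB, of dim_col] arg_cong[OF BA, of dim_col] A by auto
  have "A \<in> Units (ring_mat TYPE(complex) n ())"
    using A B AB BA unfolding Units_def ring_mat_def by auto
  then obtain C where "mat_inverse A = Some C"
    using mat_inverse(1)[OF A, of "()"] by (cases "mat_inverse A") auto
  thus "mat_inv A \<in> carrier_mat n n" "A * mat_inv A = 1\<^sub>m n" "mat_inv A * A = 1\<^sub>m n"
    using mat_inverse(2)[OF A] unfolding mat_inv_def by auto
qed

lemma invertible_matI:
  assumes "A \<in> carrier_mat n n" "B \<in> carrier_mat n n" "A * B = 1\<^sub>m n" "B * A = 1\<^sub>m n"
  shows "invertible_mat A"
  using assms unfolding invertible_mat_def inverts_mat_def by auto

lemma invertible_matI_right:
  fixes A :: "'a :: field mat"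
  assumes "A \<in> carrier_mat n n" "B \<in> carrier_mat n n" "A * B = 1\<^sub>m n"
  shows "invertible_mat A"
  using invertible_matI[OF assms mat_mult_left_right_inverse[OF assms]] .

lemma mat_inv_eqI:
  assumes A: "A \<in> carrier_mat n n" and B: "B \<in> carrier_mat n n" and AB: "A * B = 1\<^sub>m n"
  shows "mat_inv A = B"
proof -
  note i = mat_inv_props[OF A invertible_matI_right[OF assms]]
  have "mat_inv A = mat_inv A * (A * B)" using i AB by simp
  also have "\<dots> = B" using i A B assoc_mult_mat[OF i(1) A B, symmetric] by simp
  finally show ?thesis .
qed

lemma mat_mult_cancel_left:
  fixes A :: "complex mat"
  assumes A: "A \<in> carrier_mat n n" "invertible_mat A"
    and B: "B \<in> carrier_mat n m" "C \<in> carrier_mat n m" and eq: "A * B = A * C"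
  shows "B = C"
proof -
  note i = mat_inv_props[OF A]
  have "mat_inv A * A * B = mat_inv A * A * C"
    using eq assoc_mult_mat[OF i(1) A(1) B(1)] assoc_mult_mat[OF i(1) A(1) B(2)] by simp
  thus ?thesis using i B by simp
qed

lemma invertible_mat_mult:
  fixes A B :: "complex mat"
  assumes A: "A \<in> carrier_mat n n" "invertible_mat A" and B: "B \<in> carrier_mat n n" "invertible_mat B"
  shows "invertible_mat (A * B)" "mat_inv (A * B) = mat_inv B * mat_inv A"
proof -
  note a = mat_inv_props[OF A] and b = mat_inv_props[OF B]
  note assoc = assoc_mult_mat[where n\<^sub>1 = n and n\<^sub>2 = n and n\<^sub>3 = n and n\<^sub>4 = n]
  have "B * (mat_inv B * mat_inv A) = mat_inv A"
    using a b B assoc[of B "mat_inv B" "mat_inv A"] by simp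
  hence "A * B * (mat_inv B * mat_inv A) = 1\<^sub>m n" using A B a b by (simp add: assoc)
  thus "invertible_mat (A * B)" "mat_inv (A * B) = mat_inv B * mat_inv A"
    using invertible_matI_right[OF mult_carrier_mat[OF A(1) B(1)] mult_carrier_mat[OF b(1) a(1)]]
      mat_inv_eqI[OF mult_carrier_mat[OF A(1) B(1)] mult_carrier_mat[OF b(1) a(1)]]
    by blast+
qed

text \<open>The inverse of the product yields a right inverse of \<open>A\<close> and a left inverse
  of \<open>B\<close>; for square matrices over a field one side suffices.\<close>

lemma invertible_mat_factors:
  fixes A B :: "complex mat"
  assumes A: "A \<in> carrier_mat n n" and B: "B \<in> carrier_mat n n" and inv: "invertible_mat (A * B)"
  shows "invertible_mat A" "invertible_mat B"
proof -
  note i = mat_inv_props[OF mult_carrier_mat[OF A B] inv]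
  have "A * (B * mat_inv (A * B)) = 1\<^sub>m n"
    using i A B assoc_mult_mat[OF A B i(1)] by simp
  thus "invertible_mat A"
    by (rule invertible_matI_right[OF A mult_carrier_mat[OF B i(1)]])
  have BA: "mat_inv (A * B) * A * B = 1\<^sub>m n"
    using i A B assoc_mult_mat[OF i(1) A B] by simp
  have "B * (mat_inv (A * B) * A) = 1\<^sub>m n"
    by (rule mat_mult_left_right_inverse[OF _ B BA]) (use i A in auto)
  thus "invertible_mat B"
    by (rule invertible_matI_right[OF B mult_carrier_mat[OF i(1) A]])
qed

lemma invertible_mat_if_no_zero_eigenvalue:
  fixes A :: "complex mat"
  assumes A: "A \<in> carrier_mat n n" and "\<not> eigenvalue A 0"
  shows "invertible_mat A"
proof -
  have "char_matrix A 0 = A" unfolding char_matrix_def using A by (intro eq_matI) auto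
  hence "det A \<noteq> 0" using assms eigenvalue_det[OF A] by simp
  from det_non_zero_imp_unit[OF A this] show ?thesis
    using invertible_matI[OF A] unfolding Units_def ring_mat_def by auto
qed

lemma eigenvalue_conjugate:
  fixes A :: "complex mat"
  assumes "A \<in> carrier_mat n n" "P \<in> carrier_mat n n" "Q \<in> carrier_mat n n"
    and "P * Q = 1\<^sub>m n" "Q * P = 1\<^sub>m n"
  shows "eigenvalue (P * A * Q) l \<longleftrightarrow> eigenvalue A l"
proof -
  have c: "P * A * Q \<in> carrier_mat n n" using assms by simp
  have "similar_mat (P * A * Q) A"
    by (rule similar_matI[of _ _ P Q n]) (use assms c in auto)
  thus ?thesis
    using char_poly_similar eigenvalue_root_char_poly[OF c] eigenvalue_root_char_poly[OF assms(1)]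
    by metis
qed

section \<open>The star operation and adjoints\<close>

lemma star_carrier: "A \<in> carrier_mat n m \<Longrightarrow> star k A \<in> carrier_mat m n"
  by (cases k) auto

lemma map_mat_cnj_mult:
  assumes "A \<in> carrier_mat n m" "B \<in> carrier_mat m l"
  shows "map_mat cnj (A * B) = map_mat cnj A * map_mat cnj B"
  using assms by (intro eq_matI) (auto simp: scalar_prod_def)

lemma star_mult:
  assumes "A \<in> carrier_mat n m" "B \<in> carrier_mat m l"
  shows "star k (A * B) = star k B * star k A"
proof (cases k)
  case Bilinear
  thus ?thesis using transpose_mult[OF assms] by simp
next
  case Sesquilinear
  thus ?thesis
    using map_mat_cnj_mult[OF assms] transpose_mult[of "map_mat cnj A" n m "map_mat cnj B" l] assms by simp
qed

lemma star_one [simp]: "star k (1\<^sub>m n) = 1\<^sub>m n"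
  by (cases k) (auto intro!: eq_matI)

lemma adj_carrier [simp]:
  assumes "N \<in> carrier_mat n n" "invertible_mat N" "A \<in> carrier_mat n n"
  shows "adj k N A \<in> carrier_mat n n"
  using assms mat_inv_props(1)[OF assms(1,2)] star_carrier[OF assms(3), of k] unfolding adj_def by simp

lemma adj_mult:
  assumes N: "N \<in> carrier_mat n n" "invertible_mat N"
    and A: "A \<in> carrier_mat n n" and B: "B \<in> carrier_mat n n"
  shows "adj k N (A * B) = adj k N B * adj k N A"
proof -
  note i = mat_inv_props[OF N]
  note assoc = assoc_mult_mat[where n\<^sub>1 = n and n\<^sub>2 = n and n\<^sub>3 = n and n\<^sub>4 = n]
  have "N * (mat_inv N * Z) = Z" if "Z \<in> carrier_mat n n" for Z
    using that i N assoc[of N "mat_inv N" Z] by simp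
  thus ?thesis
    unfolding adj_def star_mult[OF A B] using i N star_carrier[OF A, of k] star_carrier[OF B, of k] by (simp add: assoc)
qed

lemma adj_one:
  assumes "N \<in> carrier_mat n n" "invertible_mat N"
  shows "adj k N (1\<^sub>m n) = 1\<^sub>m n"
  using assms mat_inv_props[OF assms] unfolding adj_def by simp

lemma invertible_adj:
  assumes N: "N \<in> carrier_mat n n" "invertible_mat N" and A: "A \<in> carrier_mat n n" "invertible_mat A"
  shows "invertible_mat (adj k N A)"
proof -
  note a = mat_inv_props[OF A]
  have "adj k N A * adj k N (mat_inv A) = 1\<^sub>m n"
    unfolding adj_mult[OF N a(1) A(1), symmetric] a(3) by (rule adj_one[OF N])
  thus ?thesis
    by (rule invertible_matI_right[OF adj_carrier[OF N A(1)] adj_carrier[OF N a(1)]])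
qed

text \<open>The adjoint for \<open>N * C\<close> is the adjoint for \<open>N\<close> conjugated by
  \<open>C\<close>. For an \<open>N\<close>-selfadjoint \<open>S\<close>, being selfadjoint for
  \<open>N * C\<close> thus means commuting with \<open>C\<close>.\<close>

lemma selfadjoint_mult_iff:
  assumes N: "N \<in> carrier_mat n n" "invertible_mat N" and C: "C \<in> carrier_mat n n" "invertible_mat C"
    and S: "S \<in> carrier_mat n n" and sa: "selfadjoint k N S"
  shows "selfadjoint k (N * C) S \<longleftrightarrow> S * C = C * S"
proof -
  note i = mat_inv_props[OF N] and c = mat_inv_props[OF C]
  note assoc = assoc_mult_mat[where n\<^sub>1 = n and n\<^sub>2 = n and n\<^sub>3 = n and n\<^sub>4 = n]
  have "adj k (N * C) S = mat_inv C * (adj k N S * C)"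
    unfolding adj_def invertible_mat_mult(2)[OF N C] using N C star_carrier[OF S, of k] i c by (simp add: assoc)
  hence eq: "adj k (N * C) S = mat_inv C * (S * C)" using sa unfolding selfadjoint_def by simp
  have cancel: "C * (mat_inv C * Z) = Z" "mat_inv C * (C * Z) = Z" if "Z \<in> carrier_mat n n" for Z
    using that C c assoc[of C "mat_inv C" Z] assoc[of "mat_inv C" C Z] by auto
  show ?thesis
    unfolding selfadjoint_def eq using cancel[of S] cancel[of "S * C"] C S by auto
qed

text \<open>Here \<open>adj2 k N (N * mat_inv C) W\<close> simplifies to
  \<open>C * adj k N W\<close>, so unitarity says that this product is the inverse of
  \<open>W\<close>.\<close>

lemma unitary2_mult_inv_iff:
  assumes N: "N \<in> carrier_mat n n" "invertible_mat N" and C: "C \<in> carrier_mat n n" "invertible_mat C"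
    and W: "W \<in> carrier_mat n n"
  shows "unitary2 k N (N * mat_inv C) W \<longleftrightarrow>
    C * adj k N W * W = 1\<^sub>m n \<and> W * (C * adj k N W) = 1\<^sub>m n"
proof -
  note i = mat_inv_props[OF N] and c = mat_inv_props[OF C]
  note assoc = assoc_mult_mat[where n\<^sub>1 = n and n\<^sub>2 = n and n\<^sub>3 = n and n\<^sub>4 = n]
  have ic: "invertible_mat (mat_inv C)" "mat_inv (mat_inv C) = C"
    using invertible_matI_right[OF c(1) C(1) c(3)] mat_inv_eqI[OF c(1) C(1) c(3)] by auto
  have "adj2 k N (N * mat_inv C) W = C * adj k N W"
    unfolding adj2_def adj_def invertible_mat_mult(2)[OF N c(1) ic(1)] ic(2)
    using N C star_carrier[OF W, of k] i by (simp add: assoc)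
  thus ?thesis unfolding unitary2_def using W by simp
qed

lemma unitary2_mult_iff:
  assumes N: "N \<in> carrier_mat n n" "invertible_mat N" and C: "C \<in> carrier_mat n n"
    and W: "W \<in> carrier_mat n n"
  shows "unitary2 k (N * C) N W \<longleftrightarrow>
    adj k N W * C * W = 1\<^sub>m n \<and> W * (adj k N W * C) = 1\<^sub>m n"
proof -
  note i = mat_inv_props[OF N]
  have "adj2 k (N * C) N W = adj k N W * C"
    unfolding adj2_def adj_def using N C star_carrier[OF W, of k] i
    by (simp add: assoc_mult_mat[where n\<^sub>1 = n and n\<^sub>2 = n and n\<^sub>3 = n and n\<^sub>4 = n])
  thus ?thesis unfolding unitary2_def using W by simp
qed

section \<open>Closure of matrices over the chosen field\<close>

lemma mats_carrier: "A \<in> mats K n \<Longrightarrow> A \<in> carrier_mat n n"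
  unfolding mats_def by simp

lemma mats_UNIV: "mats UNIV n = carrier_mat n n"
  unfolding mats_def by simp

text \<open>Real matrices as fixed points of entrywise conjugation: closure under an operation then
  follows from its compatibility with conjugation.\<close>

lemma mats_Reals: "mats \<real> n = {A \<in> carrier_mat n n. map_mat cnj A = A}"
proof -
  have "elements_mat A \<subseteq> \<real> \<longleftrightarrow> map_mat cnj A = A" if A: "A \<in> carrier_mat n n" for A
  proof
    assume sub: "elements_mat A \<subseteq> \<real>"
    show "map_mat cnj A = A"
    proof (rule eq_matI)
      fix i j assume "i < dim_row A" "j < dim_col A"
      moreover from this have "A $$ (i, j) \<in> \<real>" using sub A elements_matI[OF A, of i j] by auto
      ultimately show "map_mat cnj A $$ (i, j) = A $$ (i, j)" by (simp add: Reals_cnj_iff)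
    qed auto
  next
    assume eq: "map_mat cnj A = A"
    show "elements_mat A \<subseteq> \<real>"
    proof
      fix x assume "x \<in> elements_mat A"
      then obtain i j where ij: "i < dim_row A" "j < dim_col A" "x = A $$ (i, j)" by blast
      hence "cnj x = x" using arg_cong[OF eq, of "\<lambda>M. M $$ (i, j)"] by simp
      thus "x \<in> \<real>" by (simp add: Reals_cnj_iff)
    qed
  qed
  thus ?thesis unfolding mats_def by blast
qed

lemma mats_mult:
  assumes K: "K = \<real> \<or> K = UNIV" and "A \<in> mats K n" "B \<in> mats K n"
  shows "A * B \<in> mats K n"
  using K
proof
  assume "K = \<real>"
  thus ?thesis
    using assms map_mat_cnj_mult[of A n n B n] mult_carrier_mat[of A n n B n]
    by (metis (mono_tags, lifting) mats_Reals mem_Collect_eq)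
qed (use assms in \<open>simp add: mats_UNIV\<close>)

text \<open>For real \<open>A\<close>, conjugating \<open>A * mat_inv A = 1\<close> shows that the
  conjugate of \<open>mat_inv A\<close> is also an inverse of \<open>A\<close>, hence equal to
  it.\<close>

lemma mats_inv:
  assumes K: "K = \<real> \<or> K = UNIV" and A: "A \<in> mats K n" "invertible_mat A"
  shows "mat_inv A \<in> mats K n"
proof -
  note i = mat_inv_props[OF mats_carrier[OF A(1)] A(2)]
  show ?thesis using K
  proof
    assume K: "K = \<real>"
    have "map_mat cnj (A * mat_inv A) = 1\<^sub>m n" unfolding i(2) by (intro eq_matI) auto
    hence "A * map_mat cnj (mat_inv A) = 1\<^sub>m n"
      using map_mat_cnj_mult[OF mats_carrier[OF A(1)] i(1)] A(1) unfolding K mats_Reals by simp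
    hence "mat_inv A = map_mat cnj (mat_inv A)"
      using i(1) by (intro mat_inv_eqI[OF mats_carrier[OF A(1)]]) auto
    thus ?thesis using i(1) unfolding K mats_Reals by simp
  qed (use i in \<open>simp add: mats_UNIV\<close>)
qed

lemma mats_star:
  assumes K: "K = \<real> \<or> K = UNIV" and A: "A \<in> mats K n"
  shows "star k A \<in> mats K n"
  using K
proof
  assume K: "K = \<real>"
  have "map_mat cnj (transpose_mat A) = transpose_mat (map_mat cnj A)" by (intro eq_matI) auto
  thus ?thesis using A unfolding K mats_Reals by (cases k) auto
qed (use star_carrier[OF mats_carrier[OF A]] in \<open>simp add: mats_UNIV\<close>)

lemma mats_adj:
  assumes K: "K = \<real> \<or> K = UNIV" and "N \<in> mats K n" "invertible_mat N" "A \<in> mats K n"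
  shows "adj k N A \<in> mats K n"
  unfolding adj_def using assms by (intro mats_mult[OF K] mats_inv[OF K] mats_star[OF K])

subsection \<open>The two decompositions\<close>

text \<open>Eigenvalues of modulus 1 exclude the eigenvalue 0.\<close>

lemma generalized_sign_function_value:
  assumes \<sigma>: "generalized_sign_function K n \<sigma>" and A: "A \<in> mats K n" "invertible_mat A"
  shows "\<sigma> A \<in> mats K n" "invertible_mat (\<sigma> A)"
proof -
  have *: "\<sigma> A \<in> mats K n" "\<And>l. eigenvalue (\<sigma> A) l \<Longrightarrow> cmod l = 1"
    using \<sigma> A unfolding generalized_sign_function_def by auto
  thus "\<sigma> A \<in> mats K n" by blast
  show "invertible_mat (\<sigma> A)"
    using invertible_mat_if_no_zero_eigenvalue[OF mats_carrier[OF *(1)]] *(2)[of 0] by auto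
qed

text \<open>One stem function serves all nonsingular arguments, so
  \<open>primary_value_intertwine\<close> applies to the pair \<open>A\<close>,
  \<open>C\<close>.\<close>

lemma generalized_sign_function_intertwine:
  assumes \<sigma>: "generalized_sign_function K n \<sigma>"
    and A: "A \<in> mats K n" "invertible_mat A" and C: "C \<in> mats K n" "invertible_mat C"
    and T: "T \<in> carrier_mat n n" and eq: "C * T = T * A"
  shows "\<sigma> C * T = T * \<sigma> A"
proof -
  obtain f where "\<And>A. A \<in> mats K n \<Longrightarrow> invertible_mat A \<Longrightarrow> primary_value f A (\<sigma> A)"
    using \<sigma> unfolding generalized_sign_function_def by blast
  thus ?thesis
    using primary_value_intertwine[OF mats_carrier[OF A(1)] mats_carrier[OF C(1)] T eq] A C by blast
qed

context
  fixes K :: "complex set" and n :: nat and k :: form_kind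
    and N F :: "complex mat" and \<sigma> :: "complex mat \<Rightarrow> complex mat"
  assumes K: "K = \<real> \<or> K = UNIV"
    and N: "N \<in> mats K n" "invertible_mat N"
    and \<sigma>: "generalized_sign_function K n \<sigma>"
    and F: "F \<in> mats K n" "invertible_mat F"
begin

private lemmas Nc = mats_carrier[OF N(1)]
private lemmas Fc = mats_carrier[OF F(1)]
private lemmas assoc = assoc_mult_mat[where n\<^sub>1 = n and n\<^sub>2 = n and n\<^sub>3 = n and n\<^sub>4 = n]

private lemmas Ac = adj_carrier[OF Nc N(2) Fc, of k]
private lemmas Ai = invertible_adj[OF Nc N(2) Fc F(2), of k]
private lemmas product1 = mats_mult[OF K mats_adj[OF K N F(1), of k] F(1)]
  invertible_mat_mult(1)[OF Ac Ai Fc F(2)]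
private lemmas product2 = mats_mult[OF K F(1) mats_adj[OF K N F(1), of k]]
  invertible_mat_mult(1)[OF Fc F(2) Ac Ai]
private lemmas Sigma = generalized_sign_function_value[OF \<sigma> product1]
private lemmas Sigma' = generalized_sign_function_value[OF \<sigma> product2]

text \<open>The adjoint reverses products, so \<open>F * adj k N F\<close> is
  \<open>S * (W * V) * S\<close>, where \<open>V\<close> is the adjoint of \<open>W\<close> and
  \<open>W * V\<close> is inverse to \<open>C\<close>. Since \<open>S\<close> commutes with
  \<open>C\<close>, multiplying by \<open>C\<close> leaves \<open>S * S\<close>.\<close>

lemma left_decomposition_square:
  assumes "left_decomposition K n k N \<sigma> F S W"
  shows "S * S = \<sigma> (F * adj k N F) * (F * adj k N F)"
proof -
  define C where "C = \<sigma> (F * adj k N F)"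
  have C: "C \<in> carrier_mat n n" "invertible_mat C"
    using Sigma' mats_carrier unfolding C_def by auto
  have S: "S \<in> carrier_mat n n" and W: "W \<in> carrier_mat n n" and FSW: "F = S * W"
    and sa: "selfadjoint k N S" "selfadjoint k (N * C) S" and un: "unitary2 k (N * C) N W"
    using assms mats_carrier unfolding left_decomposition_def Let_def C_def by auto
  have comm: "S * C = C * S" using sa selfadjoint_mult_iff[OF Nc N(2) C S] by simp
  define V where "V = adj k N W"
  have V: "V \<in> carrier_mat n n" unfolding V_def using Nc N(2) W by simp
  have WVC: "W * V * C = 1\<^sub>m n"
    using un unitary2_mult_iff[OF Nc N(2) C(1) W] assoc[OF W V C(1)] unfolding V_def by simp
  \<comment> \<open>Unitarity puts \<open>C\<close> to the right of \<open>W * V\<close>; the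
    computation below needs it on the left.\<close>
  have CWV: "C * (W * V) = 1\<^sub>m n"
    by (rule mat_mult_left_right_inverse[OF _ C(1) WVC]) (use W V in simp)
  have "adj k N F = V * S"
    unfolding FSW adj_mult[OF Nc N(2) S W] V_def using sa(1) unfolding selfadjoint_def by simp
  hence "C * (F * adj k N F) = C * S * (W * V * S)"
    using FSW C S W V by (simp add: assoc)
  also have "\<dots> = S * (C * (W * V)) * S"
    unfolding comm[symmetric] using C S W V by (simp add: assoc)
  also have "\<dots> = S * S" unfolding CWV using S by simp
  finally show ?thesis unfolding C_def by simp
qed

lemma left_decomposition_factors:
  assumes "left_decomposition K n k N \<sigma> F S W"
  shows "S = principal_sqrt (\<sigma> (F * adj k N F) * (F * adj k N F))" "W = mat_inv S * F"
proof -
  have S: "S \<in> carrier_mat n n" and W: "W \<in> carrier_mat n n" and FSW: "F = S * W"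
    and rp: "r_positive_definite S"
    using assms mats_carrier unfolding left_decomposition_def Let_def by auto
  show "S = principal_sqrt (\<sigma> (F * adj k N F) * (F * adj k N F))"
    using principal_sqrt_eqI[OF S left_decomposition_square[OF assms] rp] by simp
  have "invertible_mat S" using invertible_mat_factors(1)[OF S W] F(2) FSW by simp
  note i = mat_inv_props[OF S this]
  show "W = mat_inv S * F"
    unfolding FSW using assoc[OF i(1) S W] i W by simp
qed

text \<open>Everything is transported along \<open>W\<close> by three relations:
  \<open>C * V = X\<close> from unitarity, \<open>D * W = W * C\<close> from the sign function, and
  their consequence \<open>V * D = X\<close>.\<close>

lemma left_decomposition_of_right:
  assumes "right_decomposition K n k N \<sigma> F W S"
  shows "left_decomposition K n k N \<sigma> F (W * S * mat_inv W) W"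
proof -
  define C where "C = \<sigma> (adj k N F * F)"
  define D where "D = \<sigma> (F * adj k N F)"
  have C: "C \<in> carrier_mat n n" "invertible_mat C"
    using Sigma mats_carrier unfolding C_def by auto
  have D: "D \<in> carrier_mat n n" "invertible_mat D"
    using Sigma' mats_carrier unfolding D_def by auto
  have SK: "S \<in> mats K n" and WK: "W \<in> mats K n" and FWS: "F = W * S"
    and rp: "r_positive_definite S"
    and sa: "selfadjoint k N S" "selfadjoint k (N * C) S" and un: "unitary2 k N (N * mat_inv C) W"
    using assms unfolding right_decomposition_def Let_def C_def by auto
  note S = mats_carrier[OF SK] and W = mats_carrier[OF WK]
  have comm: "S * C = C * S" using sa selfadjoint_mult_iff[OF Nc N(2) C S] by simp
  have Wi: "invertible_mat W" and Si: "invertible_mat S"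
    using invertible_mat_factors[OF W S] F(2) FWS by auto
  define X where "X = mat_inv W"
  note i = mat_inv_props[OF W Wi, folded X_def]
  define V where "V = adj k N W"
  have V: "V \<in> carrier_mat n n" unfolding V_def using Nc N(2) W by simp
  have "W * (C * V) = 1\<^sub>m n"
    using un unitary2_mult_inv_iff[OF Nc N(2) C W] unfolding V_def by simp
  hence CV: "C * V = X" using mat_inv_eqI[OF W mult_carrier_mat[OF C(1) V]] unfolding X_def by simp
  \<comment> \<open>\<open>F\<close> itself intertwines the two products, hence also their
    signs.\<close>
  have "F * adj k N F * F = F * (adj k N F * F)"
    using Fc Nc N(2) by (simp add: assoc)
  from generalized_sign_function_intertwine[OF \<sigma> product1 product2 Fc this]
  have "D * F = F * C" unfolding C_def D_def .
  hence DWS: "D * W * S = W * C * S"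
    unfolding FWS using D W S C comm by (simp add: assoc)
  \<comment> \<open>\<open>S\<close> commutes with \<open>C\<close> and is invertible, so it cancels
    on the right.\<close>
  have DW: "D * W = W * C"
  proof -
    note s = mat_inv_props[OF S Si]
    have "D * W * S * mat_inv S = W * C * S * mat_inv S" unfolding DWS ..
    thus ?thesis using D W S C s by (simp add: assoc)
  qed
  have cancel: "X * (W * Z) = Z" "W * (X * Z) = Z" if "Z \<in> carrier_mat n n" for Z
    using that i W assoc[of X W Z] assoc[of W X Z] by auto
  have D_eq: "D = W * C * X"
  proof -
    have "D = D * W * X" using D W i by (simp add: assoc)
    thus ?thesis unfolding DW .
  qed
  \<comment> \<open>This is the unitarity required of \<open>W\<close> in the left decomposition; it
    is checked after multiplying by the invertible \<open>C\<close>.\<close>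
  have VD: "V * D = X"
  proof -
    have "C * (V * D) = X * D" using assoc[OF C(1) V D(1)] CV by simp
    also have "\<dots> = C * X" unfolding D_eq using W C i by (simp add: assoc cancel)
    finally show ?thesis
      by (rule mat_mult_cancel_left[OF C mult_carrier_mat[OF V D(1)] i(1)])
  qed
  define R where "R = W * S * X"
  have RK: "R \<in> mats K n"
    unfolding R_def X_def by (intro mats_mult[OF K] WK SK mats_inv[OF K WK Wi])
  note R = mats_carrier[OF RK]
  have FRW: "F = R * W" unfolding R_def FWS using W S i by (simp add: assoc)
  have rpR: "r_positive_definite R"
    using rp eigenvalue_conjugate[OF S W i(1,2,3)] unfolding R_def r_positive_definite_def by simp
  \<comment> \<open>The adjoint of \<open>F\<close> is computed twice: \<open>F = W * S\<close>
    gives \<open>S * V\<close>, which equals \<open>V * R\<close>, and \<open>F = R * W\<close>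
    gives \<open>V * adj k N R\<close>. The invertible \<open>V\<close> then cancels.\<close>
  have saR: "selfadjoint k N R"
  proof -
    have "C * (V * R) = X * R" using assoc[OF C(1) V R] CV by simp
    also have "\<dots> = S * X" unfolding R_def using W S i by (simp add: assoc cancel)
    also have "\<dots> = S * C * V" using assoc[OF S C(1) V] CV by simp
    also have "\<dots> = C * (S * V)" unfolding comm using assoc[OF C(1) S V] .
    finally have "V * R = S * V"
      by (rule mat_mult_cancel_left[OF C mult_carrier_mat[OF V R] mult_carrier_mat[OF S V]])
    also have "\<dots> = adj k N F"
      unfolding FWS adj_mult[OF Nc N(2) W S] V_def using sa(1) unfolding selfadjoint_def by simp
    also have "\<dots> = V * adj k N R" unfolding FRW adj_mult[OF Nc N(2) R W] V_def ..
    finally show ?thesis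
      using mat_mult_cancel_left[OF V, of R n "adj k N R"] R Nc N(2)
        invertible_adj[OF Nc N(2) W Wi, of k]
      unfolding selfadjoint_def V_def by simp
  qed
  have "R * D = W * (S * C) * X" unfolding R_def D_eq using W S C i by (simp add: assoc cancel)
  also have "\<dots> = D * R" unfolding comm R_def D_eq using W S C i by (simp add: assoc cancel)
  finally have "selfadjoint k (N * D) R"
    using selfadjoint_mult_iff[OF Nc N(2) D R saR] by simp
  moreover have "unitary2 k (N * D) N W"
    unfolding unitary2_mult_iff[OF Nc N(2) D(1) W] using VD i unfolding V_def by simp
  ultimately show ?thesis
    using RK WK FRW rpR saR unfolding left_decomposition_def Let_def D_def R_def X_def by simp
qed

lemma left_decomposition_unique:
  assumes "left_decomposition K n k N \<sigma> F S W" "left_decomposition K n k N \<sigma> F S' W'"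
  shows "S = S'" "W = W'"
  using left_decomposition_factors[OF assms(1)] left_decomposition_factors[OF assms(2)] by auto

end

theorem theorem4p2:
  fixes K :: "complex set" and n :: nat and k :: form_kind
    and N F :: "complex mat" and \<sigma> :: "complex mat \<Rightarrow> complex mat"
  assumes "K = \<real> \<or> K = UNIV"
    and "N \<in> mats K n" and "invertible_mat N"
    and "generalized_sign_function K n \<sigma>"
    and "F \<in> mats K n" and "invertible_mat F"
  shows "((\<exists>W S. right_decomposition K n k N \<sigma> F W S) \<longrightarrow>
           (\<exists>S' W'. left_decomposition K n k N \<sigma> F S' W')) \<and>
         (\<forall>S' W' S'' W''. left_decomposition K n k N \<sigma> F S' W' \<and>
            left_decomposition K n k N \<sigma> F S'' W'' \<longrightarrow> S' = S'' \<and> W' = W'') \<and>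
         (\<forall>S' W'. left_decomposition K n k N \<sigma> F S' W' \<longrightarrow>
            S' = principal_sqrt (\<sigma> (F * adj k N F) * (F * adj k N F)) \<and> W' = mat_inv S' * F) \<and>
         (\<forall>W S S' W'. right_decomposition K n k N \<sigma> F W S \<and>
            left_decomposition K n k N \<sigma> F S' W' \<longrightarrow> W' = W)"
proof (intro conjI allI impI; (elim exE conjE)?)
  show "\<exists>S' W'. left_decomposition K n k N \<sigma> F S' W'"
    if "right_decomposition K n k N \<sigma> F W S" for W S
    using left_decomposition_of_right[OF assms that] by blast
  show "S' = S''" "W' = W''"
    if "left_decomposition K n k N \<sigma> F S' W'" "left_decomposition K n k N \<sigma> F S'' W''"
    for S' W' S'' W''
    using left_decomposition_unique[OF assms that] by auto
  show "S' = principal_sqrt (\<sigma> (F * adj k N F) * (F * adj k N F))" "W' = mat_inv S' * F"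
    if "left_decomposition K n k N \<sigma> F S' W'" for S' W'
    using left_decomposition_factors[OF assms that] .
  \<comment> \<open>The left decomposition built from \<open>W\<close> and \<open>S\<close> has
    \<open>W\<close> as its second factor, so uniqueness identifies \<open>W'\<close> with
    it.\<close>
  show "W' = W"
    if "right_decomposition K n k N \<sigma> F W S" "left_decomposition K n k N \<sigma> F S' W'"
    for W S S' W'
    using left_decomposition_unique(2)[OF assms that(2) left_decomposition_of_right[OF assms that(1)]] .
qed

end
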